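(* The space $2^{\mathbb N}_f$ is universal for the class of finite $T_0$ topological spaces; that is, every finite $T_0$ topological space admits a topological embedding into $2^{\mathbb N}_f$.
   Context: $2^{\mathbb N}_f$ denotes the set of all finite non-empty subsets of $\mathbb N$ with the upper semifinite topology coming from the discrete topology on $\mathbb N$, i.e. the topology with base the sets $\{C\subseteq\mathbb N: C\neq\emptyset \text{ finite},\ C\subseteq U\}$, $U\subseteq\mathbb N$. *)

theory Defs
  imports "HOL-Analysis.Analysis"
begin

definition upper_basic :: "'a set \<Rightarrow> 'a set set" where
  "upper_basic U = {C. C \<noteq> {} \<and> finite C \<and> C \<subseteq> U}"

definition finite_upper_semifinite :: "'a topology \<Rightarrow> 'a set topology" where
  "finite_upper_semifinite X =
     topology (arbitrary union_of (\<lambda>\<U>. \<exists>U. openin X U \<and> \<U> = upper_basic U))"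

(* The type constructor topology is total, so the definition is only meaningful because the sets
   upper_basic U really form a base; this is what the next lemma establishes. *)
lemma openin_finite_upper_semifinite:
  "openin (finite_upper_semifinite X) =
     arbitrary union_of (\<lambda>\<U>. \<exists>U. openin X U \<and> \<U> = upper_basic U)"
proof -
  have "istopology (arbitrary union_of (\<lambda>\<U>. \<exists>U. openin X U \<and> \<U> = upper_basic U))"
  proof (rule istopology_base)
    fix S T :: "'a set set"
    assume "\<exists>U. openin X U \<and> S = upper_basic U" "\<exists>U. openin X U \<and> T = upper_basic U"
    then obtain U V where "openin X U" "S = upper_basic U" "openin X V" "T = upper_basic V"
      by blast
    moreover have "upper_basic U \<inter> upper_basic V = upper_basic (U \<inter> V)"
      by (auto simp: upper_basic_def)
    ultimately show "\<exists>U. openin X U \<and> S \<inter> T = upper_basic U"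
      by (metis openin_Int)
  qed
  then show ?thesis
    by (simp add: finite_upper_semifinite_def)
qed

lemma openin_upper_basic:
  assumes "openin X U"
  shows "openin (finite_upper_semifinite X) (upper_basic U)"
  unfolding openin_finite_upper_semifinite
  by (rule arbitrary_union_of_inc) (use assms in blast)

lemma topspace_finite_upper_semifinite:
  "topspace (finite_upper_semifinite X) = {C. C \<noteq> {} \<and> finite C \<and> C \<subseteq> topspace X}"
proof -
  have "topspace (finite_upper_semifinite X) \<subseteq> upper_basic (topspace X)"
  proof
    fix C assume C: "C \<in> topspace (finite_upper_semifinite X)"
    have "(arbitrary union_of (\<lambda>\<U>. \<exists>U. openin X U \<and> \<U> = upper_basic U))
        (topspace (finite_upper_semifinite X))"
      using openin_topspace[of "finite_upper_semifinite X"]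
      unfolding openin_finite_upper_semifinite .
    with C obtain U where "openin X U" "C \<in> upper_basic U"
      unfolding arbitrary_union_of_alt by blast
    then show "C \<in> upper_basic (topspace X)"
      using openin_subset[of X U] unfolding upper_basic_def by blast
  qed
  moreover have "upper_basic (topspace X) \<subseteq> topspace (finite_upper_semifinite X)"
    by (rule openin_subset[OF openin_upper_basic[OF openin_topspace]])
  ultimately show ?thesis
    unfolding upper_basic_def by (rule subset_antisym)
qed

abbreviation finite_subsets_nat :: "nat set topology" where
  "finite_subsets_nat \<equiv> finite_upper_semifinite (discrete_topology (UNIV :: nat set))"

end

theory Submission
  imports Defs
begin

text \<open>In a finite space every point \<open>x\<close> has a least open neighbourhood \<open>U\<^sub>x\<close>, and
  \<open>y \<in> U\<^sub>x\<close> holds exactly when \<open>U\<^sub>y \<subseteq> U\<^sub>x\<close>. A finite set \<open>C\<close> in the upper semifinite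
  hyperspace of a discrete space likewise has a least open neighbourhood, namely the set of its
  non-empty subsets. So \<open>x \<mapsto> U\<^sub>x\<close> translates the topology of a finite space into inclusion, which
  is what the topology of the hyperspace records; the \<open>T\<^sub>0\<close> axiom says that distinct points
  have distinct least neighbourhoods. Numbering the points of the space by natural numbers turns
  the sets \<open>U\<^sub>x\<close> into finite sets of natural numbers.\<close>

definition least_nbhd :: "'a topology \<Rightarrow> 'a \<Rightarrow> 'a set" where
  "least_nbhd X x = \<Inter>{U. openin X U \<and> x \<in> U}"

lemma mem_least_nbhd: "x \<in> least_nbhd X x"
  by (simp add: least_nbhd_def)

lemma least_nbhd_subset: "openin X U \<Longrightarrow> x \<in> U \<Longrightarrow> least_nbhd X x \<subseteq> U"
  by (auto simp: least_nbhd_def)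

lemma openin_least_nbhd:
  assumes "finite (topspace X)" "x \<in> topspace X"
  shows "openin X (least_nbhd X x)"
proof -
  have "{U. openin X U \<and> x \<in> U} \<subseteq> Pow (topspace X)"
    by (auto dest: openin_subset)
  then have "finite {U. openin X U \<and> x \<in> U}"
    using assms(1) by (meson finite_Pow_iff finite_subset)
  moreover have "{U. openin X U \<and> x \<in> U} \<noteq> {}"
    using assms(2) openin_topspace by blast
  ultimately show ?thesis
    unfolding least_nbhd_def by (intro openin_Inter) auto
qed

lemma least_nbhd_subset_topspace: "x \<in> topspace X \<Longrightarrow> least_nbhd X x \<subseteq> topspace X"
  by (simp add: least_nbhd_subset)

text \<open>If \<open>x\<close> and \<open>y\<close> have the same least neighbourhood, then each lies in every open set
  containing the other, so no open set separates them.\<close>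

lemma inj_on_least_nbhd:
  assumes "t0_space X"
  shows "inj_on (least_nbhd X) (topspace X)"
proof (rule inj_onI, rule ccontr)
  fix x y
  assume xy: "x \<in> topspace X" "y \<in> topspace X" "least_nbhd X x = least_nbhd X y" "x \<noteq> y"
  then obtain U where "openin X U" "x \<notin> U \<longleftrightarrow> y \<in> U"
    using assms unfolding t0_space_def by blast
  then show False
    using xy(3) least_nbhd_subset[of X U x] least_nbhd_subset[of X U y]
      mem_least_nbhd[of x X] mem_least_nbhd[of y X] by auto
qed

text \<open>A basic open set is closed under passing to non-empty subsets, and \<open>y \<in> U\<^sub>x\<close> gives
  \<open>U\<^sub>y \<subseteq> U\<^sub>x\<close>. So a basic set that contains the image of \<open>x\<close> also contains the images of all
  points of \<open>U\<^sub>x\<close>.\<close>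

lemma continuous_map_image_least_nbhd:
  assumes fin: "finite (topspace X)" and g: "g ` topspace X \<subseteq> topspace Y"
  shows "continuous_map X (finite_upper_semifinite Y) (\<lambda>x. g ` least_nbhd X x)"
proof -
  let ?f = "\<lambda>x. g ` least_nbhd X x"
  have f_top: "?f x \<noteq> {} \<and> finite (?f x) \<and> ?f x \<subseteq> topspace Y" if "x \<in> topspace X" for x
    using least_nbhd_subset_topspace[OF that] mem_least_nbhd[of x X] fin g
    by (auto intro: finite_subset)
  show ?thesis
    unfolding continuous_map_def
  proof (intro conjI allI impI)
    show "?f \<in> topspace X \<rightarrow> topspace (finite_upper_semifinite Y)"
      using f_top by (simp add: topspace_finite_upper_semifinite)
  next
    fix W assume W: "openin (finite_upper_semifinite Y) W"
    show "openin X {x \<in> topspace X. ?f x \<in> W}"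
    proof (subst openin_subopen, intro ballI)
      fix x assume "x \<in> {x \<in> topspace X. ?f x \<in> W}"
      then have x: "x \<in> topspace X" "?f x \<in> W" by auto
      obtain V where V: "?f x \<in> upper_basic V" "upper_basic V \<subseteq> W"
        using W x(2) unfolding openin_finite_upper_semifinite arbitrary_union_of_alt by blast
      have op: "openin X (least_nbhd X x)"
        by (rule openin_least_nbhd[OF fin x(1)])
      have "least_nbhd X x \<subseteq> {x \<in> topspace X. ?f x \<in> W}"
      proof
        fix y assume y: "y \<in> least_nbhd X x"
        have "y \<in> topspace X"
          using y least_nbhd_subset_topspace[OF x(1)] by blast
        moreover have "?f y \<subseteq> ?f x"
          by (rule image_mono[OF least_nbhd_subset[OF op y]])
        ultimately have "?f y \<in> upper_basic V"
          using V(1) f_top[of y] unfolding upper_basic_def by blast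
        then show "y \<in> {x \<in> topspace X. ?f x \<in> W}"
          using V(2) \<open>y \<in> topspace X\<close> by blast
      qed
      then show "\<exists>T. openin X T \<and> x \<in> T \<and> T \<subseteq> {x \<in> topspace X. ?f x \<in> W}"
        using op mem_least_nbhd[of x X] by blast
    qed
  qed
qed

text \<open>Since \<open>U\<close> is open exactly when it contains \<open>U\<^sub>x\<close> for each of its points \<open>x\<close>, the image
  of an open \<open>U\<close> is the trace of the basic open set given by \<open>g ` U\<close>. Discreteness of the target
  is what makes \<open>g ` U\<close> available for every \<open>U\<close>.\<close>

lemma embedding_map_image_least_nbhd:
  fixes g :: "'a \<Rightarrow> 'b"
  assumes fin: "finite (topspace X)" and t0: "t0_space X" and inj: "inj_on g (topspace X)"
  shows "embedding_map X (finite_upper_semifinite (discrete_topology UNIV))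
           (\<lambda>x. g ` least_nbhd X x)"
proof -
  let ?Y = "finite_upper_semifinite (discrete_topology (UNIV :: 'b set))"
  let ?f = "\<lambda>x. g ` least_nbhd X x"
  let ?Z = "subtopology ?Y (?f ` topspace X)"
  have cont: "continuous_map X ?Y ?f"
    using fin by (intro continuous_map_image_least_nbhd) auto
  have image_subset_iff: "?f x \<subseteq> g ` U \<longleftrightarrow> least_nbhd X x \<subseteq> U"
    if "x \<in> topspace X" "U \<subseteq> topspace X" for x U
    by (rule inj_on_image_subset_iff[OF inj least_nbhd_subset_topspace[OF that(1)] that(2)])
  have "open_map X ?Z ?f"
    unfolding open_map_def
  proof (intro allI impI)
    fix U assume U: "openin X U"
    then have sub: "U \<subseteq> topspace X" by (rule openin_subset)
    have "?f x \<in> upper_basic (g ` U) \<longleftrightarrow> x \<in> U" if x: "x \<in> topspace X" for x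
    proof -
      have "finite (?f x)" "?f x \<noteq> {}"
        using least_nbhd_subset_topspace[OF x] mem_least_nbhd[of x X] fin
        by (auto intro: finite_subset)
      then have "?f x \<in> upper_basic (g ` U) \<longleftrightarrow> least_nbhd X x \<subseteq> U"
        using image_subset_iff[OF x sub] by (simp add: upper_basic_def)
      also have "\<dots> \<longleftrightarrow> x \<in> U"
        using least_nbhd_subset[OF U, of x] mem_least_nbhd[of x X] by blast
      finally show ?thesis .
    qed
    then have "?f ` U = upper_basic (g ` U) \<inter> ?f ` topspace X"
      using sub by blast
    then show "openin ?Z (?f ` U)"
      unfolding openin_subtopology
      using openin_upper_basic[of "discrete_topology UNIV" "g ` U"] by auto
  qed
  moreover have "inj_on ?f (topspace X)"
  proof (rule inj_onI)
    fix x y assume "x \<in> topspace X" "y \<in> topspace X" "?f x = ?f y"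
    then show "x = y"
      using inj_on_image_eq_iff[OF inj least_nbhd_subset_topspace least_nbhd_subset_topspace]
        inj_on_least_nbhd[OF t0] by (meson inj_on_def)
  qed
  moreover have "continuous_map X ?Z ?f"
    using cont by (simp add: continuous_map_in_subtopology)
  moreover have "?f ` topspace X = topspace ?Z"
    using continuous_map_image_subset_topspace[OF cont] by (auto simp: topspace_subtopology)
  ultimately show ?thesis
    unfolding embedding_map_def by (intro bijective_open_imp_homeomorphic_map)
qed

theorem corollary2:
  fixes X :: "'a topology"
  assumes "finite (topspace X)" and "t0_space X"
  shows "\<exists>f. embedding_map X finite_subsets_nat f"
proof -
  obtain g :: "'a \<Rightarrow> nat" where "inj_on g (topspace X)"
    using finite_imp_inj_to_nat_seg[OF assms(1)] by blast
  then show ?thesis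
    using embedding_map_image_least_nbhd[OF assms] by blast
qed

end
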